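(* For a nonnegative integer $m$, consider bivariate $m$-nomials $f$ and let $Z$ be the zero set of $f$ in $\mathbb{R}^2_+$. Let $S(m)$ be the maximal number of isolated singular points of such a $Z$, $I(m)$ the maximal number of isolated inflection points of such a $Z$, and $V(m)$ the maximal number of isolated points of vertical tangency of such a $Z$. Then: (4) $S(m)\leq \mathcal{K}(2,m)$ and $V(m)\leq\mathcal{K}(2,m)$. (5) $S(m)+I(m)\leq 3\,\mathcal{K}'(2,m)$ for $m\leq 3$.
   Context: For $a=(a_1,\ldots,a_n)\in\mathbb{R}^n$ write $x^a:=x_1^{a_1}\cdots x_n^{a_n}$; a monomial term is $cx^a$ with $c\in\mathbb{R}\setminus\{0\}$. Exponents are arbitrary real vectors. The positive orthant is $\mathbb{R}^n_+:=\{x\in\mathbb{R}^n \mid x_i>0 \text{ for all } i\}$. An $n$-variate $m$-nomial is a finite real linear combination of such $x^a$ with exactly $m$ monomial terms (i.e. $m$ distinct exponent vectors with nonzero coefficients). A $k\times n$ fewnomial system of type $(m_1,\ldots,m_k)$, with all $m_i\geq 1$, is $F=(f_1,\ldots,f_k)$ where $f_i$ is an $n$-variate $m_i$-nomial; its exponent vectors are those occurring in any of the $f_i$. An arc is a point or a homeomorphic image of the unit circle or of an (open, closed, or half-open) unit interval. A real root $\zeta$ of $F$ is isolated iff the only arc of real roots of $F$ containing $\zeta$ is $\zeta$ itself; it is non-degenerate iff the Jacobian of $F$, evaluated at $\zeta$, has full rank. $\mathcal{K}(n,\mu)$ (resp. $\mathcal{K}'(n,\mu)$) denotes the maximal number of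 isolated (resp. non-degenerate) roots in $\mathbb{R}^n_+$ of an $n\times n$ fewnomial system with exactly $\mu$ distinct exponent vectors, and $\mathcal{K}(n,0):=0$ (so also $\mathcal{K}'(n,0)=0$, in accordance with $\mathcal{K}'\leq\mathcal{K}$). Inflection points (resp. points of vertical tangency) are called isolated if they are isolated relative to the locus of inflection points (resp. of points of vertical tangency) of $Z$. *)

theory Defs
  imports
    "HOL-Analysis.Analysis"
    "HOL-Library.Poly_Mapping"
    "HOL-Library.Extended_Nat"
begin

section \<open>Fewnomials\<close>

text \<open>
  A finite real linear combination of monomials \<open>x\<^sup>a\<close> with pairwise distinct real exponent vectors
  \<open>a\<close> is encoded by its finitely supported coefficient function; \<open>Poly_Mapping.keys f\<close> is the set of
  exponent vectors that occur in \<open>f\<close> with a nonzero coefficient.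
\<close>

type_synonym 'n fewnomial = "(real ^ 'n) \<Rightarrow>\<^sub>0 real"

definition positive_orthant :: "(real ^ 'n) set" where
  "positive_orthant = {x. \<forall>i. 0 < x $ i}"

definition monomial_val :: "real ^ 'n::finite \<Rightarrow> real ^ 'n \<Rightarrow> real" where
  "monomial_val a x = (\<Prod>i\<in>UNIV. x $ i powr a $ i)"

definition feval :: "'n::finite fewnomial \<Rightarrow> real ^ 'n \<Rightarrow> real" where
  "feval f x = (\<Sum>a\<in>Poly_Mapping.keys f. Poly_Mapping.lookup f a * monomial_val a x)"

definition is_nomial :: "nat \<Rightarrow> 'n::finite fewnomial \<Rightarrow> bool" where
  "is_nomial m f \<longleftrightarrow> card (Poly_Mapping.keys f) = m"

definition zero_set :: "'n::finite fewnomial \<Rightarrow> (real ^ 'n) set" where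
  "zero_set f = {x \<in> positive_orthant. feval f x = 0}"


section \<open>Fewnomial systems\<close>

text \<open>A \<open>k \<times> n\<close> system is a family of \<open>k = CARD('k)\<close> fewnomials in \<open>n = CARD('n)\<close> variables.\<close>

definition fewnomial_system :: "('k::finite \<Rightarrow> 'n::finite fewnomial) \<Rightarrow> bool" where
  "fewnomial_system F \<longleftrightarrow> (\<forall>i. \<exists>m\<ge>1. is_nomial m (F i))"

definition system_exponents :: "('k::finite \<Rightarrow> 'n::finite fewnomial) \<Rightarrow> (real ^ 'n) set" where
  "system_exponents F = (\<Union>i. Poly_Mapping.keys (F i))"

definition system_eval :: "('k::finite \<Rightarrow> 'n::finite fewnomial) \<Rightarrow> real ^ 'n \<Rightarrow> real ^ 'k" where
  "system_eval F x = (\<chi> i. feval (F i) x)"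

definition system_roots :: "('k::finite \<Rightarrow> 'n::finite fewnomial) \<Rightarrow> (real ^ 'n) set" where
  "system_roots F = {x \<in> positive_orthant. system_eval F x = 0}"


section \<open>Arcs and isolated points\<close>

definition is_arc :: "'a::topological_space set \<Rightarrow> bool" where
  "is_arc C \<longleftrightarrow>
     (\<exists>p. C = {p}) \<or>
     C homeomorphic sphere (0 :: real ^ 2) 1 \<or>
     C homeomorphic {0<..<1::real} \<or>
     C homeomorphic {0..1::real} \<or>
     C homeomorphic {0..<1::real} \<or>
     C homeomorphic {0<..1::real}"

text \<open>
  Points isolated in the sense of arcs, relative to a set \<open>S\<close>; the topological notion
  \<^const>\<open>isolated_in\<close> is a different definition.
\<close>

definition arc_isolated :: "'a::topological_space set \<Rightarrow> 'a set" where
  "arc_isolated S = {z \<in> S. \<forall>C. is_arc C \<and> C \<subseteq> S \<and> z \<in> C \<longrightarrow> C = {z}}"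


section \<open>Maximal numbers of roots\<close>

definition ecard :: "'a set \<Rightarrow> enat" where
  "ecard A = (if finite A then enat (card A) else \<infinity>)"

definition nondegenerate_roots :: "('k::finite \<Rightarrow> 'n::finite fewnomial) \<Rightarrow> (real ^ 'n) set" where
  "nondegenerate_roots F = {z \<in> system_roots F.
     rank (jacobian (system_eval F) (at z)) = min CARD('k) CARD('n)}"

text \<open>
  Maxima are suprema in \<^typ>\<open>enat\<close>. No system has \<open>0\<close> exponent vectors, so both numbers
  below are \<open>0\<close> for \<open>\<mu> = 0\<close>, the supremum of the empty set being \<open>0\<close>.
\<close>

definition max_isolated_roots :: "'n::finite itself \<Rightarrow> nat \<Rightarrow> enat" where
  "max_isolated_roots (_ :: 'n itself) \<mu> =
     (SUP F \<in> {F :: 'n \<Rightarrow> 'n fewnomial. fewnomial_system F \<and> card (system_exponents F) = \<mu>}.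
        ecard (arc_isolated (system_roots F)))"

definition max_nondegenerate_roots :: "'n::finite itself \<Rightarrow> nat \<Rightarrow> enat" where
  "max_nondegenerate_roots (_ :: 'n itself) \<mu> =
     (SUP F \<in> {F :: 'n \<Rightarrow> 'n fewnomial. fewnomial_system F \<and> card (system_exponents F) = \<mu>}.
        ecard (nondegenerate_roots F))"


section \<open>Special points of plane fewnomial curves\<close>

definition singular_points :: "2 fewnomial \<Rightarrow> (real ^ 2) set" where
  "singular_points f = {z \<in> zero_set f. frechet_derivative (feval f) (at z) = (\<lambda>v. 0)}"

text \<open>
  Tangent lines are those at nonsingular points: a nonzero \<open>v\<close> spans the tangent direction at \<open>z\<close>
  iff the derivative of \<open>f\<close> at \<open>z\<close> annihilates \<open>v\<close>.
\<close>

definition tangent_direction :: "2 fewnomial \<Rightarrow> real ^ 2 \<Rightarrow> real ^ 2 \<Rightarrow> bool" where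
  "tangent_direction f z v \<longleftrightarrow>
     z \<in> zero_set f - singular_points f \<and> v \<noteq> 0 \<and> frechet_derivative (feval f) (at z) v = 0"

definition vertical_tangency_points :: "2 fewnomial \<Rightarrow> (real ^ 2) set" where
  "vertical_tangency_points f = {z. tangent_direction f z (axis 2 1)}"

text \<open>
  At an inflection point the tangent line meets the curve with multiplicity at least \<open>3\<close>, that is,
  \<open>f\<close> restricted to the tangent line vanishes to order at least \<open>3\<close> (its value and first derivative
  vanish by tangency). Equivalently, the curvature is zero, so a line segment contained in the curve
  consists of (non-isolated) inflection points.
\<close>

definition inflection_points :: "2 fewnomial \<Rightarrow> (real ^ 2) set" where
  "inflection_points f =
     {z. \<exists>v. tangent_direction f z v \<and> (deriv ^^ 2) (\<lambda>t::real. feval f (z + t *\<^sub>R v)) 0 = 0}"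

definition max_isolated_singular :: "nat \<Rightarrow> enat" where
  "max_isolated_singular m =
     (SUP f \<in> {f :: 2 fewnomial. is_nomial m f}. ecard (arc_isolated (singular_points f)))"

definition max_isolated_inflection :: "nat \<Rightarrow> enat" where
  "max_isolated_inflection m =
     (SUP f \<in> {f :: 2 fewnomial. is_nomial m f}. ecard (arc_isolated (inflection_points f)))"

definition max_isolated_vertical_tangency :: "nat \<Rightarrow> enat" where
  "max_isolated_vertical_tangency m =
     (SUP f \<in> {f :: 2 fewnomial. is_nomial m f}. ecard (arc_isolated (vertical_tangency_points f)))"

end

theory Submission
  imports Defs "HOL-Computational_Algebra.Polynomial"
begin

text \<open>
  In the coordinates \<open>u\<^sub>i = ln x\<^sub>i\<close> a fewnomial is an exponential sum, and its directional
  derivative along a constant vector \<open>w\<close> is again an exponential sum with the same exponents.  The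
  bounds by \<open>max_isolated_roots\<close> therefore come from the square system formed by \<open>f\<close> and such a
  derivative (plus a multiple of \<open>f\<close>), for a suitable \<open>w\<close>.  What has to be seen is that a point that
  is isolated on the smaller locus stays isolated among the roots of this system.

  For vertical tangencies \<open>w\<close> is the second axis.  The additional roots are the singular points, and
  these form a closed set that misses every vertical tangency.

  For singular points \<open>w\<close> is generic, so that the numbers \<open>a \<bullet> w\<close> are distinct for distinct exponents
  \<open>a\<close>.  At a nonsingular root the curve is tangent to \<open>w\<close>.  An arc of roots through such a point would
  be a smooth piece of the curve with constant tangent direction, hence a segment parallel to \<open>w\<close>,
  on which a sum of distinct exponentials would vanish identically
  (\<open>exp_sum_no_tangent_continuum\<close>, \<open>no_arc_through_nonsingular_point\<close>).  So every nondegenerate arc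
  of roots consists of singular points.

  With at most three terms, either the exponents lie on a line or they are the corners of a
  triangle.  In the first case the curve, its singular points and its inflection points are
  invariant under a one-parameter group of translations in logarithmic coordinates, so that none of
  these points is isolated.  In the second case there are no singular points.  The curve is
  injectively parametrised by the ratio of two of the terms, and the inflection condition is a
  polynomial equation of degree at most \<open>3\<close> in this ratio.  Either this polynomial vanishes identically, and then the inflection
  points fill the curve and none is isolated, or there are at most three of them.  The system
  \<open>x = y = 1\<close> shows that \<open>max_nondegenerate_roots\<close> is at least \<open>1\<close> for three exponents.
\<close>

section \<open>Arcs\<close>

lemma is_arc_connected_locally_path_connected:
  fixes C :: "'a::euclidean_space set"
  assumes "is_arc C"
  shows "connected C" and "locally path_connected C"
proof -
  have sphere: "connected (sphere (0 :: real ^ 2) 1)" "locally path_connected (sphere (0 :: real ^ 2) 1)"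
    by (auto intro!: connected_sphere locally_path_connected_sphere)
  have curve: "connected C \<and> locally path_connected C" if "C homeomorphic sphere (0 :: real ^ 2) 1"
    using sphere homeomorphic_locally[OF that, of path_connected path_connected, OF homeomorphic_path_connectedness]
      homeomorphic_connectedness[OF that] by simp
  have interval: "connected C \<and> locally path_connected C" if "C homeomorphic T" "convex T" for T :: "real set"
    using convex_connected[OF that(2)] convex_imp_locally_path_connected[OF that(2)]
      homeomorphic_locally[OF that(1), of path_connected path_connected, OF homeomorphic_path_connectedness]
      homeomorphic_connectedness[OF that(1)] by simp
  have point: "connected {p} \<and> locally path_connected {p}" for p :: 'a
    by (simp add: convex_imp_locally_path_connected)
  have "connected C \<and> locally path_connected C"
    using assms unfolding is_arc_def
    by (elim disjE exE) (simp add: point, erule curve, (erule interval, simp)+)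
  then show "connected C" and "locally path_connected C" by auto
qed

text \<open>
  Arcs are connected and locally path connected, so a nondegenerate arc has no isolated points and
  contains small nondegenerate paths through each of its points.  This makes the absence of arcs
  through a point a local condition.
\<close>
lemma is_arc_contains_small_arc:
  fixes C :: "'a::euclidean_space set"
  assumes C: "is_arc C" "z \<in> C" "C \<noteq> {z}" and U: "open U" "z \<in> U"
  obtains A where "is_arc A" "A \<subseteq> C \<inter> U" "z \<in> A" "A \<noteq> {z}"
proof -
  note conn = is_arc_connected_locally_path_connected[OF C(1)]
  have "openin (top_of_set C) (C \<inter> U)" "z \<in> C \<inter> U"
    using U C by (auto simp: openin_open_Int)
  then obtain W where W: "openin (top_of_set C) W" "path_connected W" "z \<in> W" "W \<subseteq> C \<inter> U"
    using conn(2) locally_path_connected_2[of C "C \<inter> U" z] 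
    by (metis locally_path_connected)
  have "W \<noteq> {z}"
  proof
    assume "W = {z}"
    then have "openin (top_of_set C) {z}" "closedin (top_of_set C) {z}"
      using W C by (auto simp: closedin_closed_eq closedin_singleton)
    then show False
      using conn(1) C unfolding connected_clopen by blast
  qed
  then obtain q where q: "q \<in> W" "q \<noteq> z" using W(3) by blast
  then obtain g where g: "arc g" "path_image g \<subseteq> W" "pathstart g = z" "pathfinish g = q"
    using W unfolding path_connected_arcwise by metis
  have "path_image g homeomorphic {0..1::real}"
    using homeomorphic_arc_image_interval[OF g(1), of 0 1] by simp
  then have "is_arc (path_image g)" unfolding is_arc_def by blast
  moreover have "z \<in> path_image g" "q \<in> path_image g"
    using g pathstart_in_path_image pathfinish_in_path_image by metis+
  moreover have "path_image g \<subseteq> C \<inter> U" using g(2) W(4) by (rule order_trans)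
  ultimately show thesis using that[of "path_image g"] q(2) by fast
qed

lemma not_arc_isolated_if_curve:
  fixes \<gamma> :: "real \<Rightarrow> 'a::t2_space"
  assumes d: "d > 0" and cont: "continuous_on {-d..d} \<gamma>" and inj: "inj_on \<gamma> {-d..d}"
    and sub: "\<And>t. t \<in> {-d..d} \<Longrightarrow> \<gamma> t \<in> S"
  shows "\<gamma> 0 \<notin> arc_isolated S"
proof
  assume iso: "\<gamma> 0 \<in> arc_isolated S"
  have "{-d..d} homeomorphic \<gamma> ` {-d..d}"
    by (rule homeomorphic_compact[OF _ cont refl inj]) auto
  moreover have "{-d..d} homeomorphic {0..1::real}"
    using d by (intro homeomorphic_closed_intervals_real) auto
  ultimately have "is_arc (\<gamma> ` {-d..d})"
    unfolding is_arc_def by (meson homeomorphic_sym homeomorphic_trans)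
  moreover have "\<gamma> ` {-d..d} \<subseteq> S" "\<gamma> 0 \<in> \<gamma> ` {-d..d}" using sub d by auto
  ultimately have "\<gamma> ` {-d..d} = {\<gamma> 0}"
    using iso unfolding arc_isolated_def by simp
  moreover have "\<gamma> d \<in> \<gamma> ` {-d..d}" using d by simp
  ultimately have "\<gamma> d = \<gamma> 0" by simp
  with inj_onD[OF inj, of d 0] d show False by auto
qed


section \<open>Exponential sums\<close>

lemma exponentials_linearly_independent:
  fixes C lam :: "'a \<Rightarrow> real"
  assumes "finite K" "inj_on lam K" "l < r"
    and "\<And>s. s \<in> {l<..<r} \<Longrightarrow> (\<Sum>a\<in>K. C a * exp (lam a * s)) = 0"
  shows "\<forall>a\<in>K. C a = 0"
  using assms
proof (induction K arbitrary: C rule: finite_induct)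
  case empty
  then show ?case by simp
next
  case (insert b K)
  let ?G = "\<lambda>s. \<Sum>a\<in>insert b K. C a * exp (lam a * s)"
  \<comment> \<open>The operator \<open>d/ds - lam b\<close> kills the \<open>b\<close>-th exponential and scales the others by nonzero factors.\<close>
  have "(\<Sum>a\<in>K. (C a * (lam a - lam b)) * exp (lam a * s)) = 0" if s: "s \<in> {l<..<r}" for s
  proof -
    have "(?G has_real_derivative (\<Sum>a\<in>insert b K. C a * (lam a * exp (lam a * s)))) (at s)"
      by (auto intro!: derivative_eq_intros sum.cong simp: mult_ac)
    moreover have "(?G has_real_derivative 0) (at s)"
      by (rule has_field_derivative_transform_within_open[of "\<lambda>_. 0" _ _ "{l<..<r}"])
        (use s insert.prems(3) in auto)
    ultimately have "(\<Sum>a\<in>insert b K. C a * (lam a * exp (lam a * s))) = 0"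
      using DERIV_unique by blast
    with insert.prems(3)[OF s]
    have "(\<Sum>a\<in>insert b K. C a * (lam a * exp (lam a * s))) - lam b * ?G s = 0" by simp
    also have "(\<Sum>a\<in>insert b K. C a * (lam a * exp (lam a * s))) - lam b * ?G s
        = (\<Sum>a\<in>insert b K. (C a * (lam a - lam b)) * exp (lam a * s))"
      by (simp only: sum_distrib_left sum_subtractf[symmetric]) (auto intro!: sum.cong simp: algebra_simps)
    finally show ?thesis using insert.hyps by simp
  qed
  then have "\<forall>a\<in>K. C a * (lam a - lam b) = 0"
    using insert.IH[of "\<lambda>a. C a * (lam a - lam b)"] insert.prems by auto
  moreover have "lam a \<noteq> lam b" if "a \<in> K" for a
    using insert.prems(1) insert.hyps that by (auto simp: inj_on_def)
  ultimately have K: "\<forall>a\<in>K. C a = 0" by auto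
  moreover have "(l + r) / 2 \<in> {l<..<r}" using \<open>l < r\<close> by auto
  then have "?G ((l + r) / 2) = 0" using insert.prems(3) by blast
  with K insert.hyps have "C b = 0" by simp
  ultimately show ?case by auto
qed

text \<open>
  On \<open>M\<close> the second coordinate is a function of the first, and the hypothesis makes its derivative
  zero.
\<close>
lemma connected_quadratic_bound_horizontal:
  fixes M :: "(real \<times> real) set"
  assumes M: "connected M"
    and bound: "\<And>s t s' t'. (s, t) \<in> M \<Longrightarrow> (s', t') \<in> M \<Longrightarrow> \<bar>t' - t\<bar> \<le> L * (s' - s)\<^sup>2"
  shows "\<exists>c. M \<subseteq> UNIV \<times> {c}"
proof -
  define \<tau> where "\<tau> s = (SOME t. (s, t) \<in> M)" for s
  have graph: "\<tau> s = t" if "(s, t) \<in> M" for s t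
  proof -
    have "(s, \<tau> s) \<in> M" unfolding \<tau>_def using that by (rule someI)
    from bound[OF this that] show ?thesis by simp
  qed
  have "connected (fst ` M)" using M by (intro connected_continuous_image continuous_intros)
  then have conv: "convex (fst ` M)" 
    by (simp add: is_interval_connected_1 flip: is_interval_convex_1)
  have "(\<tau> has_field_derivative 0) (at s within fst ` M)" if s: "s \<in> fst ` M" for s
  proof -
    have lim: "((\<lambda>y. \<bar>L\<bar> * \<bar>y - s\<bar>) \<longlongrightarrow> 0) (at s within fst ` M)"
      by (rule tendsto_eq_intros refl | simp)+
    have "\<forall>\<^sub>F y in at s within fst ` M. norm ((\<tau> y - \<tau> s) / (y - s)) \<le> \<bar>L\<bar> * \<bar>y - s\<bar>"
      unfolding eventually_at_filter
    proof (intro always_eventually allI impI)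
      fix y assume y: "y \<noteq> s" "y \<in> fst ` M"
      have "\<bar>\<tau> y - \<tau> s\<bar> \<le> L * (y - s)\<^sup>2" using s y graph bound by fastforce
      also have "\<dots> \<le> \<bar>L\<bar> * (y - s)\<^sup>2" by (intro mult_right_mono) auto
      also have "\<dots> = (\<bar>L\<bar> * \<bar>y - s\<bar>) * \<bar>y - s\<bar>" by (simp add: power2_eq_square)
      finally show "norm ((\<tau> y - \<tau> s) / (y - s)) \<le> \<bar>L\<bar> * \<bar>y - s\<bar>"
        using y by (simp add: abs_divide pos_divide_le_eq)
    qed
    then have "((\<lambda>y. (\<tau> y - \<tau> s) / (y - s)) \<longlongrightarrow> 0) (at s within fst ` M)"
      by (rule Lim_null_comparison[OF _ lim])
    then show ?thesis by (simp add: has_field_derivative_iff)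
  qed
  then obtain c where "\<forall>s\<in>fst ` M. \<tau> s = c"
    using has_field_derivative_zero_constant[OF conv] by blast
  then have "M \<subseteq> UNIV \<times> {c}" using graph by force
  then show ?thesis ..
qed

lemma mean_value_closed_segment:
  fixes f f' :: "real \<Rightarrow> real"
  assumes "\<And>x. (f has_real_derivative f' x) (at x)"
  shows "\<exists>x\<in>closed_segment a b. f b - f a = f' x * (b - a)"
proof -
  consider "a < b" | "b < a" | "a = b" by linarith
  then show ?thesis
  proof cases
    case 1
    with MVT2[of a b f f'] assms show ?thesis
      by (force simp: closed_segment_eq_real_ivl mult.commute)
  next
    case 2
    with MVT2[of b a f f'] assms obtain x where "b < x" "x < a" "f a - f b = (a - b) * f' x" by blast
    with 2 show ?thesis
      by (intro bexI[of _ x]) (auto simp: closed_segment_eq_real_ivl algebra_simps)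
  qed auto
qed

text \<open>
  Where \<open>g = 0\<close> is a smooth curve with \<open>g\<^sub>t \<noteq> 0\<close>, the equation \<open>g\<^sub>s = 0\<close> makes its tangent
  horizontal.  A connected piece \<open>M\<close> of \<open>g = g\<^sub>s = 0\<close> with more than one point is therefore a
  horizontal segment, on which \<open>g\<close> is a vanishing sum of distinct exponentials in \<open>s\<close>.
\<close>
lemma exp_sum_no_tangent_continuum:
  fixes C lam mu :: "'a \<Rightarrow> real"
  defines "g \<equiv> \<lambda>K s t. \<Sum>a\<in>K. C a * exp (lam a * s + mu a * t)"
    and "gs \<equiv> \<lambda>K s t. \<Sum>a\<in>K. C a * lam a * exp (lam a * s + mu a * t)"
  assumes fin: "finite K" and inj: "inj_on lam K" and ndeg: "(\<Sum>a\<in>K. C a * mu a) \<noteq> 0"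
  obtains r where "r > 0"
    "\<And>M. \<lbrakk>connected M; (0, 0) \<in> M; M \<subseteq> {-r..r} \<times> {-r..r};
           \<And>s t. (s, t) \<in> M \<Longrightarrow> g K s t = 0 \<and> gs K s t = 0\<rbrakk> \<Longrightarrow> M = {(0, 0)}"
proof -
  define gt where "gt s t = (\<Sum>a\<in>K. C a * mu a * exp (lam a * s + mu a * t))" for s t
  define gss where "gss s t = (\<Sum>a\<in>K. C a * (lam a)\<^sup>2 * exp (lam a * s + mu a * t))" for s t
  have ders: "((\<lambda>s. g K s t) has_real_derivative gs K s t) (at s)"
    "((\<lambda>s. gs K s t) has_real_derivative gss s t) (at s)"
    "((\<lambda>t. g K s t) has_real_derivative gt s t) (at t)" for s t
    unfolding g_def gs_def gt_def gss_def
    by (auto intro!: derivative_eq_intros sum.cong simp: power2_eq_square algebra_simps)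
  have cont: "continuous_on UNIV (\<lambda>p. gt (fst p) (snd p))" "continuous_on A (\<lambda>p. gss (fst p) (snd p))" for A
    unfolding gt_def gss_def by (intro continuous_intros)+
  define k where "k = \<bar>gt 0 0\<bar> / 2"
  have k: "k > 0" using ndeg by (simp add: k_def gt_def)
  have "open ((\<lambda>p. \<bar>gt (fst p) (snd p)\<bar>) -` {k<..})"
    by (intro open_vimage continuous_on_rabs cont) auto
  moreover have "(0, 0) \<in> (\<lambda>p. \<bar>gt (fst p) (snd p)\<bar>) -` {k<..}" using k by (simp add: k_def)
  ultimately obtain e where e: "e > 0" "ball (0, 0) e \<subseteq> (\<lambda>p. \<bar>gt (fst p) (snd p)\<bar>) -` {k<..}"
    using open_contains_ball by blast
  define r where "r = e / 3"
  have r: "r > 0" using e by (simp add: r_def)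
  have gt_lower: "k \<le> \<bar>gt s t\<bar>" if "s \<in> {-r..r}" "t \<in> {-r..r}" for s t
  proof -
    have "norm (s, t) \<le> \<bar>s\<bar> + \<bar>t\<bar>" using norm_Pair_le[of s t] by simp
    also have "\<dots> < e" using that e(1) by (auto simp: r_def)
    finally have "(s, t) \<in> ball (0, 0) e" by (simp add: zero_prod_def[symmetric])
    then show ?thesis using e(2) by auto
  qed
  have "compact ((\<lambda>p. gss (fst p) (snd p)) ` ({-r..r} \<times> {-r..r}))"
    by (intro compact_continuous_image cont compact_Times) auto
  then obtain B where "B > 0" "\<forall>y\<in>(\<lambda>p. gss (fst p) (snd p)) ` ({-r..r} \<times> {-r..r}). norm y \<le> B"
    using compact_imp_bounded bounded_pos by metis
  then have B: "B > 0" "\<And>s t. s \<in> {-r..r} \<Longrightarrow> t \<in> {-r..r} \<Longrightarrow> \<bar>gss s t\<bar> \<le> B"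
    by force+
  show thesis
  proof (rule that[OF r])
    fix M assume M: "connected M" "(0, 0) \<in> M" "M \<subseteq> {-r..r} \<times> {-r..r}"
      and zero: "\<And>s t. (s, t) \<in> M \<Longrightarrow> g K s t = 0 \<and> gs K s t = 0"
    have "\<bar>t' - t\<bar> \<le> (B / k) * (s' - s)\<^sup>2" if st: "(s, t) \<in> M" "(s', t') \<in> M" for s t s' t'
    proof -
      have box: "s \<in> {-r..r}" "t \<in> {-r..r}" "s' \<in> {-r..r}" "t' \<in> {-r..r}" using st M(3) by auto
      \<comment> \<open>Compare the value at the corner \<open>(s', t)\<close> with those at \<open>(s', t')\<close> and \<open>(s, t)\<close>.\<close>
      have "k * \<bar>t' - t\<bar> \<le> \<bar>g K s' t\<bar>"
      proof -
        have "\<exists>x\<in>closed_segment t t'. g K s' t' - g K s' t = gt s' x * (t' - t)"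
          by (rule mean_value_closed_segment) (rule ders)
        then obtain x where x: "x \<in> closed_segment t t'" "g K s' t' - g K s' t = gt s' x * (t' - t)" by blast
        have "x \<in> {-r..r}" using x(1) box by (auto simp: closed_segment_eq_real_ivl split: if_splits)
        then have "k \<le> \<bar>gt s' x\<bar>" using gt_lower box by blast
        then have "k * \<bar>t' - t\<bar> \<le> \<bar>gt s' x * (t' - t)\<bar>" by (simp add: abs_mult mult_right_mono)
        then show ?thesis using x(2) zero[OF st(2)] by simp
      qed
      also have "\<bar>g K s' t\<bar> \<le> B * (s' - s)\<^sup>2"
      proof -
        have "\<exists>x\<in>closed_segment s s'. g K s' t - g K s t = gs K x t * (s' - s)"
          by (rule mean_value_closed_segment) (rule ders)
        then obtain x where x: "x \<in> closed_segment s s'" "g K s' t - g K s t = gs K x t * (s' - s)" by blast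
        have "\<exists>y\<in>closed_segment s x. gs K x t - gs K s t = gss y t * (x - s)"
          by (rule mean_value_closed_segment) (rule ders)
        then obtain y where y: "y \<in> closed_segment s x" "gs K x t - gs K s t = gss y t * (x - s)" by blast
        have "y \<in> {-r..r}" and near: "\<bar>x - s\<bar> \<le> \<bar>s' - s\<bar>"
          using x(1) y(1) box by (auto simp: closed_segment_eq_real_ivl split: if_splits)
        then have "\<bar>gss y t\<bar> * (\<bar>x - s\<bar> * \<bar>s' - s\<bar>) \<le> B * (\<bar>s' - s\<bar> * \<bar>s' - s\<bar>)"
          using B box by (intro mult_mono mult_right_mono) auto
        then show ?thesis
          using x(2) y(2) zero[OF st(1)] by (simp add: abs_mult power2_eq_square mult.assoc)
      qed
      finally show ?thesis using k by (simp add: field_simps)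
    qed
    then obtain c where "M \<subseteq> UNIV \<times> {c}"
      using connected_quadratic_bound_horizontal[OF M(1)] by metis
    with M(2) have hor: "M \<subseteq> UNIV \<times> {0}" by auto
    show "M = {(0, 0)}"
    proof (rule ccontr)
      assume "M \<noteq> {(0, 0)}"
      then obtain s1 where s1: "(s1, 0) \<in> M" "s1 \<noteq> 0" using M(2) hor by fastforce
      have "connected (fst ` M)" using M by (intro connected_continuous_image continuous_intros)
      moreover have "0 \<in> fst ` M" "s1 \<in> fst ` M" using s1 M(2) by (auto intro: rev_image_eqI)
      ultimately have "{min 0 s1..max 0 s1} \<subseteq> fst ` M"
        using connected_contains_Icc[of "fst ` M" "min 0 s1" "max 0 s1"] by (simp add: min_def max_def)
      moreover have "g K s 0 = 0" if "s \<in> fst ` M" for s using that hor zero by auto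
      ultimately have "g K s 0 = 0" if "s \<in> {min 0 s1<..<max 0 s1}" for s
        using that by (auto simp: subset_iff)
      then have "\<forall>a\<in>K. C a = 0"
        using s1 by (intro exponentials_linearly_independent[OF fin inj, of "min 0 s1" "max 0 s1"])
          (auto simp: g_def)
      with ndeg show False by simp
    qed
  qed
qed


section \<open>Differentiating fewnomials in logarithmic coordinates\<close>

text \<open>
  In the coordinates \<open>u\<^sub>i = ln x\<^sub>i\<close> a fewnomial is the exponential sum \<open>\<Sum>a. c\<^sub>a exp (a \<bullet> u)\<close>.
  This is its directional derivative along \<open>w\<close>, that is, \<open>\<Sum>i. w\<^sub>i x\<^sub>i \<partial>f/\<partial>x\<^sub>i\<close>.
\<close>
definition log_deriv :: "'n::finite fewnomial \<Rightarrow> real ^ 'n \<Rightarrow> real ^ 'n \<Rightarrow> real" where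
  "log_deriv f w x = (\<Sum>a\<in>Poly_Mapping.keys f. Poly_Mapping.lookup f a * (a \<bullet> w) * monomial_val a x)"

text \<open>
  The second derivative of \<open>f\<close> along the straight line with velocity \<open>(w\<^sub>i x\<^sub>i)\<^sub>i\<close>.  The
  subtracted term comes from the curvature of that line in logarithmic coordinates.
\<close>
definition line_deriv2 :: "'n::finite fewnomial \<Rightarrow> real ^ 'n \<Rightarrow> real ^ 'n \<Rightarrow> real" where
  "line_deriv2 f w x = (\<Sum>a\<in>Poly_Mapping.keys f.
     Poly_Mapping.lookup f a * ((a \<bullet> w)\<^sup>2 - a \<bullet> (\<chi> i. (w $ i)\<^sup>2)) * monomial_val a x)"

text \<open>Translation by \<open>d\<close> in logarithmic coordinates.\<close>
definition torus_act :: "real ^ 'n::finite \<Rightarrow> real ^ 'n \<Rightarrow> real ^ 'n" where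
  "torus_act d x = (\<chi> i. x $ i * exp (d $ i))"

lemma positive_orthantD: "x \<in> positive_orthant \<Longrightarrow> 0 < x $ i"
  by (simp add: positive_orthant_def)

lemma positive_orthant_nonzero: "x \<in> positive_orthant \<Longrightarrow> x $ i \<noteq> 0"
  by (metis positive_orthantD less_irrefl)

lemma open_positive_orthant: "open (positive_orthant :: (real ^ 'n::finite) set)"
proof -
  have "positive_orthant = (\<Inter>i. (\<lambda>x :: real ^ 'n. x $ i) -` {0<..})"
    by (auto simp: positive_orthant_def)
  also have "open \<dots>"
    by (intro open_INT finite ballI open_vimage open_greaterThan continuous_intros)
  finally show ?thesis .
qed

lemma monomial_val_exp_ln:
  assumes "x \<in> positive_orthant"
  shows "monomial_val a x = exp (\<Sum>i\<in>UNIV. a $ i * ln (x $ i))"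
  unfolding monomial_val_def exp_sum[OF finite]
  by (intro prod.cong refl) (simp add: powr_def positive_orthant_nonzero[OF assms])

lemma monomial_val_pos: "x \<in> positive_orthant \<Longrightarrow> 0 < monomial_val a x"
  by (simp add: monomial_val_exp_ln)

lemma torus_act_in_positive_orthant [simp]: "torus_act d x \<in> positive_orthant \<longleftrightarrow> x \<in> positive_orthant"
  by (simp add: torus_act_def positive_orthant_def zero_less_mult_iff)

lemma torus_act_0 [simp]: "torus_act 0 x = x"
  by (simp add: torus_act_def vec_eq_iff)

lemma torus_act_ln_quotient:
  assumes "x \<in> positive_orthant" "y \<in> positive_orthant"
  shows "torus_act (\<chi> i. ln (y $ i / x $ i)) x = y"
  using positive_orthantD[OF assms(1)] positive_orthantD[OF assms(2)]
  by (simp add: torus_act_def vec_eq_iff positive_orthant_nonzero[OF assms(1)])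

lemma monomial_val_torus_act:
  assumes "x \<in> positive_orthant"
  shows "monomial_val a (torus_act d x) = exp (a \<bullet> d) * monomial_val a x"
proof -
  have "(\<Sum>i\<in>UNIV. a $ i * ln (x $ i * exp (d $ i)))
      = (\<Sum>i\<in>UNIV. a $ i * d $ i) + (\<Sum>i\<in>UNIV. a $ i * ln (x $ i))"
    unfolding sum.distrib[symmetric]
    by (intro sum.cong refl)
      (use positive_orthantD[OF assms] in \<open>simp add: ln_mult_pos algebra_simps\<close>)
  then show ?thesis
    using assms by (simp add: monomial_val_exp_ln) (simp add: torus_act_def inner_vec_def exp_add)
qed

lemma continuous_on_monomial_val: "continuous_on positive_orthant (monomial_val a)"
proof -
  have "continuous_on positive_orthant (\<lambda>x. exp (\<Sum>i\<in>UNIV. a $ i * ln (x $ i)))"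
    by (intro continuous_intros) (auto simp: positive_orthant_nonzero)
  then show ?thesis by (simp add: monomial_val_exp_ln cong: continuous_on_cong)
qed

lemma continuous_on_log_deriv: "continuous_on positive_orthant (log_deriv f w)"
  unfolding log_deriv_def
  by (intro continuous_intros continuous_on_monomial_val)

lemma log_deriv_add: "log_deriv f (v + w) x = log_deriv f v x + log_deriv f w x"
  by (simp add: log_deriv_def inner_add_right algebra_simps sum.distrib)

lemma log_deriv_scaleR: "log_deriv f (c *\<^sub>R w) x = c * log_deriv f w x"
  by (simp add: log_deriv_def sum_distrib_left mult_ac)

lemma line_deriv2_scaleR: "line_deriv2 f (c *\<^sub>R w) x = c\<^sup>2 * line_deriv2 f w x"
proof -
  have "(\<chi> i. ((c *\<^sub>R w) $ i)\<^sup>2) = c\<^sup>2 *\<^sub>R (\<chi> i. (w $ i)\<^sup>2)"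
    by (simp add: vec_eq_iff power_mult_distrib)
  then show ?thesis
    unfolding line_deriv2_def by (simp add: sum_distrib_left algebra_simps power_mult_distrib)
qed

lemma has_derivative_monomial_val:
  assumes "x \<in> positive_orthant"
  shows "(monomial_val a has_derivative (\<lambda>v. (a \<bullet> (\<chi> i. v $ i / x $ i)) * monomial_val a x)) (at x)"
proof -
  have "((\<lambda>x. exp (\<Sum>i\<in>UNIV. a $ i * ln (x $ i))) has_derivative
      (\<lambda>v. exp (\<Sum>i\<in>UNIV. a $ i * ln (x $ i)) * (\<Sum>i\<in>UNIV. a $ i * (v $ i / x $ i)))) (at x)"
    by (auto intro!: derivative_eq_intros bounded_linear.has_derivative[OF bounded_linear_vec_nth]
        simp: positive_orthantD[OF assms] divide_inverse mult_ac fun_eq_iff sum_distrib_left sum_distrib_right)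
  from has_derivative_transform_within_open[OF this open_positive_orthant assms]
  show ?thesis
    by (simp add: monomial_val_exp_ln[symmetric] assms inner_vec_def mult.commute)
qed

lemma has_derivative_feval:
  assumes "x \<in> positive_orthant"
  shows "(feval f has_derivative (\<lambda>v. log_deriv f (\<chi> i. v $ i / x $ i) x)) (at x)"
  unfolding feval_def[abs_def] log_deriv_def
  by (auto intro!: derivative_eq_intros has_derivative_monomial_val[OF assms] sum.cong simp: mult_ac fun_eq_iff)

lemma frechet_derivative_feval:
  assumes "x \<in> positive_orthant"
  shows "frechet_derivative (feval f) (at x) = (\<lambda>v. log_deriv f (\<chi> i. v $ i / x $ i) x)"
  using frechet_derivative_at[OF has_derivative_feval[OF assms]] by simp

lemma singular_points_iff:
  "z \<in> singular_points f \<longleftrightarrow> z \<in> zero_set f \<and> (\<forall>w. log_deriv f w z = 0)"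
proof (cases "z \<in> positive_orthant")
  case True
  note pos = positive_orthant_nonzero[OF True]
  have "w = (\<chi> i. (\<chi> i. w $ i * z $ i) $ i / z $ i)" for w :: "real ^ 2"
    using pos by (simp add: vec_eq_iff)
  then have "(\<forall>v. log_deriv f (\<chi> i. v $ i / z $ i) z = 0) \<longleftrightarrow> (\<forall>w. log_deriv f w z = 0)"
    by metis
  then show ?thesis
    unfolding singular_points_def by (simp add: frechet_derivative_feval[OF True] fun_eq_iff)
qed (simp add: singular_points_def zero_set_def)

lemma tangent_direction_iff:
  "tangent_direction f z (\<chi> i. w $ i * z $ i) \<longleftrightarrow>
     z \<in> zero_set f - singular_points f \<and> w \<noteq> 0 \<and> log_deriv f w z = 0"
proof (cases "z \<in> positive_orthant")
  case True
  note pos = positive_orthant_nonzero[OF True]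
  then have "(\<chi> i. (\<chi> i. w $ i * z $ i) $ i / z $ i) = w"
    by (simp add: vec_eq_iff)
  moreover have "(\<chi> i. w $ i * z $ i) = 0 \<longleftrightarrow> w = 0"
    using pos by (simp add: vec_eq_iff)
  ultimately show ?thesis
    unfolding tangent_direction_def using True by (simp add: frechet_derivative_feval)
qed (simp add: tangent_direction_def zero_set_def)

lemma eventually_line_in_positive_orthant:
  assumes "z \<in> positive_orthant"
  shows "\<forall>\<^sub>F t in nhds (0::real). z + t *\<^sub>R v \<in> positive_orthant"
proof -
  have "open ((\<lambda>t. z + t *\<^sub>R v) -` positive_orthant)"
    by (intro open_vimage open_positive_orthant continuous_intros)
  then show ?thesis using assms by (auto simp: eventually_nhds)
qed

lemma second_derivative_feval:
  assumes z: "z \<in> positive_orthant"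
  shows "(deriv ^^ 2) (\<lambda>t. feval f (z + t *\<^sub>R (\<chi> i. w $ i * z $ i))) 0 = line_deriv2 f w z"
proof -
  define v where "v = (\<chi> i. w $ i * z $ i)"
  define q where "q t = (\<chi> i. v $ i / (z + t *\<^sub>R v) $ i)" for t
  note line = eventually_line_in_positive_orthant[OF z, of v]
  have vec: "((\<lambda>t. z + t *\<^sub>R v) has_vector_derivative v) (at t)" for t
    by (auto intro!: derivative_eq_intros)
  have comp: "((\<lambda>t. h (z + t *\<^sub>R v)) has_real_derivative h' v) (at t)"
    if "(h has_derivative h') (at (z + t *\<^sub>R v))" for h h' t
    using vector_derivative_diff_chain_within[OF vec[of t], of h h'] that
    by (simp add: o_def has_derivative_at_withinI has_real_derivative_iff_has_vector_derivative)
  have first: "\<forall>\<^sub>F t in nhds 0. deriv (\<lambda>t. feval f (z + t *\<^sub>R v)) t = log_deriv f (q t) (z + t *\<^sub>R v)"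
    using line
    by eventually_elim (use DERIV_imp_deriv[OF comp[OF has_derivative_feval]] in \<open>simp add: q_def\<close>)
  have q0: "q 0 = w"
    by (simp add: q_def v_def vec_eq_iff positive_orthant_nonzero[OF z])
  have "((\<lambda>t. a \<bullet> q t) has_real_derivative - (a \<bullet> (\<chi> i. (w $ i)\<^sup>2))) (at 0)" for a
  proof -
    have "((\<lambda>t. \<Sum>i\<in>UNIV. a $ i * (v $ i / (z $ i + t * v $ i))) has_real_derivative
        (\<Sum>i\<in>UNIV. a $ i * - ((v $ i / z $ i)\<^sup>2))) (at 0)"
      by (auto intro!: derivative_eq_intros sum.cong
          simp: positive_orthant_nonzero[OF z] power2_eq_square divide_simps)
    moreover have "v $ i / z $ i = w $ i" for i
      by (simp add: v_def positive_orthant_nonzero[OF z])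
    ultimately show ?thesis by (simp add: q_def inner_vec_def sum_negf)
  qed
  moreover have "((\<lambda>t. monomial_val a (z + t *\<^sub>R v)) has_real_derivative (a \<bullet> w) * monomial_val a z) (at 0)" for a
    using comp[of "monomial_val a" _ 0] has_derivative_monomial_val[OF z, of a] q0
    by (auto simp: q_def)
  ultimately have "((\<lambda>t. log_deriv f (q t) (z + t *\<^sub>R v)) has_real_derivative line_deriv2 f w z) (at 0)"
    unfolding log_deriv_def line_deriv2_def
    by (auto intro!: derivative_eq_intros sum.cong simp: q0 power2_eq_square algebra_simps)
  then show ?thesis
    using deriv_cong_ev[OF first refl] DERIV_imp_deriv
    by (simp add: numeral_2_eq_2 flip: v_def)
qed

lemma inflection_points_iff:
  "z \<in> inflection_points f \<longleftrightarrow> z \<in> zero_set f - singular_points f \<and>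
     (\<exists>w. w \<noteq> 0 \<and> log_deriv f w z = 0 \<and> line_deriv2 f w z = 0)"
proof (cases "z \<in> positive_orthant")
  case True
  note pos = positive_orthant_nonzero[OF True]
  have "\<exists>w. v = (\<chi> i. w $ i * z $ i)" for v :: "real ^ 2"
    using pos by (intro exI[of _ "\<chi> i. v $ i / z $ i"]) (simp add: vec_eq_iff)
  then have "(\<exists>v. P v) \<longleftrightarrow> (\<exists>w. P (\<chi> i. w $ i * z $ i))" for P :: "real ^ 2 \<Rightarrow> bool"
    by metis
  then have "z \<in> inflection_points f \<longleftrightarrow> (\<exists>w. tangent_direction f z (\<chi> i. w $ i * z $ i) \<and>
      (deriv ^^ 2) (\<lambda>t. feval f (z + t *\<^sub>R (\<chi> i. w $ i * z $ i))) 0 = 0)"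
    unfolding inflection_points_def mem_Collect_eq .
  then show ?thesis
    unfolding second_derivative_feval[OF True] tangent_direction_iff by blast
qed (auto simp: inflection_points_def zero_set_def tangent_direction_def)

lemma vertical_tangency_points_iff:
  "z \<in> vertical_tangency_points f \<longleftrightarrow>
     z \<in> zero_set f - singular_points f \<and> log_deriv f (axis 2 1) z = 0"
proof (cases "z \<in> positive_orthant")
  case True
  note pos = positive_orthant_nonzero[OF True]
  have "axis 2 1 = (\<chi> i. ((1 / z $ 2) *\<^sub>R axis 2 1) $ i * z $ i)"
    using pos[of 2] by (simp add: vec_eq_iff axis_def)
  then have "tangent_direction f z (axis 2 1) \<longleftrightarrow>
      tangent_direction f z (\<chi> i. ((1 / z $ 2) *\<^sub>R axis 2 1) $ i * z $ i)" by simp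
  then show ?thesis
    unfolding vertical_tangency_points_def mem_Collect_eq tangent_direction_iff
    using pos[of 2] by (simp add: log_deriv_scaleR)
qed (auto simp: vertical_tangency_points_def zero_set_def tangent_direction_def)


section \<open>Isolated singular points and vertical tangencies as roots of a system\<close>

text \<open>
  Both \<open>f\<close> and \<open>log_deriv f w\<close> are combinations of the monomials of \<open>f\<close>, so pairing them introduces no
  new exponents.
\<close>
lemma fewnomial_log_deriv_system:
  fixes f :: "2 fewnomial"
  assumes "Poly_Mapping.keys f \<noteq> {}"
  obtains F :: "2 \<Rightarrow> 2 fewnomial" where "fewnomial_system F"
    "system_exponents F = Poly_Mapping.keys f"
    "system_roots F = {x \<in> zero_set f. log_deriv f w x = 0}"
proof -
  obtain b where b: "b \<in> Poly_Mapping.keys f" using assms by blast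
  \<comment> \<open>The multiple \<open>1 - b \<bullet> w\<close> of \<open>f\<close> keeps the exponent \<open>b\<close>, so the second entry is not the zero fewnomial.\<close>
  define h where "h = Poly_Mapping.mapp (\<lambda>a c. c * (1 - b \<bullet> w + a \<bullet> w)) f"
  define F where "F i = (if i = 1 then f else h)" for i :: 2
  have look: "Poly_Mapping.lookup h a = Poly_Mapping.lookup f a * (1 - b \<bullet> w + a \<bullet> w)" for a
    by (cases "a \<in> Poly_Mapping.keys f") (auto simp: h_def lookup_mapp in_keys_iff)
  have sub: "Poly_Mapping.keys h \<subseteq> Poly_Mapping.keys f"
    by (simp add: h_def keys_mapp_subset)
  have bh: "b \<in> Poly_Mapping.keys h"
    using b by (simp add: in_keys_iff look)
  have "feval h x = (\<Sum>a\<in>Poly_Mapping.keys f. Poly_Mapping.lookup h a * monomial_val a x)" for x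
    unfolding feval_def using sub by (intro sum.mono_neutral_left) (auto simp: in_keys_iff)
  then have h: "feval h x = (1 - b \<bullet> w) * feval f x + log_deriv f w x" for x
    by (simp add: look feval_def log_deriv_def sum_distrib_left sum.distrib[symmetric] algebra_simps)
  show thesis
  proof (rule that)
    have "card (Poly_Mapping.keys f) \<ge> 1" "card (Poly_Mapping.keys h) \<ge> 1"
      using b bh by (auto simp: Suc_le_eq card_gt_0_iff)
    then show "fewnomial_system F"
      by (auto simp: fewnomial_system_def is_nomial_def F_def)
    show "system_exponents F = Poly_Mapping.keys f"
      using sub by (auto simp: system_exponents_def F_def split: if_splits)
    show "system_roots F = {x \<in> zero_set f. log_deriv f w x = 0}"
      by (auto simp: system_roots_def zero_set_def system_eval_def vec_eq_iff forall_2 F_def h)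
  qed
qed

lemma ecard_mono: "A \<subseteq> B \<Longrightarrow> ecard A \<le> ecard B"
  by (auto simp: ecard_def card_mono finite_subset)

lemma ecard_le_max_isolated_roots:
  fixes f :: "2 fewnomial"
  assumes "is_nomial m f" "m > 0"
    and "A \<subseteq> arc_isolated {x \<in> zero_set f. log_deriv f w x = 0}"
  shows "ecard A \<le> max_isolated_roots TYPE(2) m"
proof -
  have "Poly_Mapping.keys f \<noteq> {}" using assms by (auto simp: is_nomial_def)
  then obtain F :: "2 \<Rightarrow> 2 fewnomial" where F: "fewnomial_system F"
      "system_exponents F = Poly_Mapping.keys f"
      "system_roots F = {x \<in> zero_set f. log_deriv f w x = 0}"
    by (rule fewnomial_log_deriv_system)
  have "ecard A \<le> ecard (arc_isolated (system_roots F))"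
    using assms(3) F(3) by (simp add: ecard_mono)
  also have "\<dots> \<le> max_isolated_roots TYPE(2) m"
    unfolding max_isolated_roots_def using F assms(1) by (intro SUP_upper) (auto simp: is_nomial_def)
  finally show ?thesis .
qed

abbreviation slope_dir :: "real \<Rightarrow> real ^ 2" where
  "slope_dir \<theta> \<equiv> (\<chi> i. if i = 1 then 1 else \<theta>)"

lemma inner_slope_dir: "a \<bullet> slope_dir \<theta> = a $ 1 + \<theta> * a $ 2"
  by (simp add: inner_vec_def sum_2)

text \<open>Each pair of distinct exponents excludes at most one slope.\<close>
lemma exists_separating_direction:
  fixes K :: "(real ^ 2) set"
  assumes "finite K"
  shows "\<exists>\<theta>. inj_on (\<lambda>a. a \<bullet> slope_dir \<theta>) K"
proof -
  define bad where "bad = (\<lambda>(a, b). - (a $ 1 - b $ 1) / (a $ 2 - b $ 2)) ` (K \<times> K)"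
  have "finite bad" using assms by (simp add: bad_def)
  then obtain \<theta> where \<theta>: "\<theta> \<notin> bad" using ex_new_if_finite infinite_UNIV_char_0 by blast
  have "a = b" if ab: "a \<in> K" "b \<in> K" "a \<bullet> slope_dir \<theta> = b \<bullet> slope_dir \<theta>" for a b
  proof -
    have eq: "(a $ 1 - b $ 1) + \<theta> * (a $ 2 - b $ 2) = 0"
      using ab(3) by (simp add: inner_slope_dir algebra_simps)
    have "a $ 2 - b $ 2 = 0"
    proof (rule ccontr)
      assume "a $ 2 - b $ 2 \<noteq> 0"
      with eq have "\<theta> = - (a $ 1 - b $ 1) / (a $ 2 - b $ 2)" by (simp add: field_simps)
      with \<theta> ab show False by (force simp: bad_def)
    qed
    with eq show ?thesis by (simp add: vec_eq_iff forall_2)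
  qed
  then show ?thesis unfolding inj_on_def by blast
qed

text \<open>
  In logarithmic coordinates a nondegenerate arc of this kind would follow the smooth curve \<open>f = 0\<close> with constant
  tangent direction \<open>w = slope_dir \<theta>\<close>, hence contain a segment in that direction; along it \<open>f\<close> is a sum of
  exponentials with rates \<open>a \<bullet> w\<close>, which are pairwise distinct.
\<close>
lemma no_arc_through_nonsingular_point:
  fixes f :: "2 fewnomial"
  assumes inj: "inj_on (\<lambda>a. a \<bullet> slope_dir \<theta>) (Poly_Mapping.keys f)"
    and C: "is_arc C" "C \<subseteq> {x \<in> zero_set f. log_deriv f (slope_dir \<theta>) x = 0}"
    and p: "p \<in> C" "p \<notin> singular_points f"
  shows "C = {p}"
proof (rule ccontr)
  assume "C \<noteq> {p}"
  have pos: "x \<in> positive_orthant" "x $ i \<noteq> 0" if "x \<in> C" for x i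
    using that C(2) positive_orthant_nonzero by (auto simp: zero_set_def)
  define c where "c a = Poly_Mapping.lookup f a * monomial_val a p" for a
  define lam where "lam a = a \<bullet> slope_dir \<theta>" for a
  define mu where "mu a = a $ 2" for a :: "real ^ 2"
  have "log_deriv f (axis 2 1) p \<noteq> 0"
  proof
    assume y: "log_deriv f (axis 2 1) p = 0"
    have "log_deriv f v p = 0" for v
    proof -
      have "v = v $ 1 *\<^sub>R slope_dir \<theta> + (v $ 2 - \<theta> * v $ 1) *\<^sub>R axis 2 1"
        by (simp add: vec_eq_iff forall_2 axis_def)
      from arg_cong[OF this, of "\<lambda>u. log_deriv f u p"]
      have "log_deriv f v p = v $ 1 * log_deriv f (slope_dir \<theta>) p
          + (v $ 2 - \<theta> * v $ 1) * log_deriv f (axis 2 1) p"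
        by (simp only: log_deriv_add log_deriv_scaleR)
      moreover have "log_deriv f (slope_dir \<theta>) p = 0" using p C(2) by blast
      ultimately show ?thesis using y by simp
    qed
    with p C(2) show False by (auto simp: singular_points_iff)
  qed
  then have "(\<Sum>a\<in>Poly_Mapping.keys f. c a * mu a) \<noteq> 0"
    by (simp add: log_deriv_def c_def mu_def inner_axis mult_ac)
  from exp_sum_no_tangent_continuum[OF finite_keys inj[folded lam_def] this]
  obtain r where r: "r > 0"
    "\<And>M. \<lbrakk>connected M; (0, 0) \<in> M; M \<subseteq> {-r..r} \<times> {-r..r};
       \<And>s t. (s, t) \<in> M \<Longrightarrow> (\<Sum>a\<in>Poly_Mapping.keys f. c a * exp (lam a * s + mu a * t)) = 0
         \<and> (\<Sum>a\<in>Poly_Mapping.keys f. c a * lam a * exp (lam a * s + mu a * t)) = 0\<rbrakk>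
     \<Longrightarrow> M = {(0, 0)}"
    by blast
  \<comment> \<open>Logarithmic coordinates at \<open>p\<close> along \<open>slope_dir \<theta>\<close> and the second axis.\<close>
  define d where "d q = (\<chi> i. ln (q $ i / p $ i))" for q :: "real ^ 2"
  define \<sigma> where "\<sigma> q = (d q $ 1, d q $ 2 - \<theta> * d q $ 1)" for q
  have cont: "continuous_on positive_orthant \<sigma>"
    unfolding \<sigma>_def d_def using pos[OF p(1)]
    by (auto intro!: continuous_intros simp: positive_orthant_nonzero)
  have recover: "torus_act (d q) p = q" if "q \<in> positive_orthant" for q
    unfolding d_def using torus_act_ln_quotient pos[OF p(1)] that by blast
  have \<sigma>p: "\<sigma> p = (0, 0)" using pos[OF p(1)] by (simp add: \<sigma>_def d_def)
  define U where "U = positive_orthant \<inter> \<sigma> -` ({-r<..<r} \<times> {-r<..<r})"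
  have "open U" unfolding U_def
    by (rule continuous_open_preimage[OF cont open_positive_orthant]) (auto intro: open_Times)
  moreover have "p \<in> U" using \<sigma>p r(1) pos[OF p(1)] by (simp add: U_def)
  ultimately obtain A where A: "is_arc A" "A \<subseteq> C \<inter> U" "p \<in> A" "A \<noteq> {p}"
    using is_arc_contains_small_arc[OF C(1) p(1) \<open>C \<noteq> {p}\<close>] by metis
  have Apos: "A \<subseteq> positive_orthant" using A(2) pos by blast
  have "\<sigma> ` A = {(0, 0)}"
  proof (rule r(2))
    show "connected (\<sigma> ` A)"
      using is_arc_connected_locally_path_connected(1)[OF A(1)] continuous_on_subset[OF cont Apos]
      by (intro connected_continuous_image)
    show "(0, 0) \<in> \<sigma> ` A" using A(3) \<sigma>p by (metis image_eqI)
    show "\<sigma> ` A \<subseteq> {-r..r} \<times> {-r..r}"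
    proof
      fix x assume "x \<in> \<sigma> ` A"
      then have "x \<in> {-r<..<r} \<times> {-r<..<r}" using A(2) by (auto simp: U_def)
      then show "x \<in> {-r..r} \<times> {-r..r}" by auto
    qed
    fix s t assume "(s, t) \<in> \<sigma> ` A"
    then obtain q where q: "q \<in> A" "\<sigma> q = (s, t)" by force
    then have qC: "q \<in> C" using A(2) by blast
    have "a \<bullet> d q = lam a * s + mu a * t" for a
      using q(2) by (auto simp: \<sigma>_def lam_def mu_def inner_slope_dir inner_vec_def sum_2 algebra_simps)
    then have mono: "monomial_val a q = exp (lam a * s + mu a * t) * monomial_val a p" for a
      using monomial_val_torus_act[of p a "d q"] recover[of q] pos(1)[OF qC] pos(1)[OF p(1)] by simp
    have "feval f q = 0" "log_deriv f (slope_dir \<theta>) q = 0"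
      using qC C(2) by (auto simp: zero_set_def)
    then show "(\<Sum>a\<in>Poly_Mapping.keys f. c a * exp (lam a * s + mu a * t)) = 0
         \<and> (\<Sum>a\<in>Poly_Mapping.keys f. c a * lam a * exp (lam a * s + mu a * t)) = 0"
      by (simp add: feval_def log_deriv_def mono c_def lam_def mult_ac)
  qed
  moreover have "q = p" if "q \<in> A" "\<sigma> q = (0, 0)" for q
  proof -
    have "d q = 0" using that(2) by (simp add: \<sigma>_def vec_eq_iff forall_2)
    then show ?thesis using recover[of q] Apos that(1) by auto
  qed
  ultimately have "A = {p}" using A(3) by blast
  with A(4) show False ..
qed

text \<open>
  A root arc through an isolated singular point either consists of singular points or contains a
  nonsingular one, and is degenerate in both cases.
\<close>
lemma arc_isolated_singular_points_subset:
  fixes f :: "2 fewnomial"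
  assumes inj: "inj_on (\<lambda>a. a \<bullet> slope_dir \<theta>) (Poly_Mapping.keys f)"
  shows "arc_isolated (singular_points f) \<subseteq>
    arc_isolated {x \<in> zero_set f. log_deriv f (slope_dir \<theta>) x = 0}" (is "_ \<subseteq> arc_isolated ?R")
proof
  fix z assume z: "z \<in> arc_isolated (singular_points f)"
  then have sing: "z \<in> singular_points f"
    and iso: "\<And>C. is_arc C \<Longrightarrow> C \<subseteq> singular_points f \<Longrightarrow> z \<in> C \<Longrightarrow> C = {z}"
    by (auto simp: arc_isolated_def)
  have "C = {z}" if C: "is_arc C" "C \<subseteq> ?R" "z \<in> C" for C
  proof (cases "C \<subseteq> singular_points f")
    case False
    then obtain p where "p \<in> C" "p \<notin> singular_points f" by blast
    then show ?thesis
      using no_arc_through_nonsingular_point[OF inj C(1,2)] C(3) by blast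
  qed (use iso C in blast)
  then show "z \<in> arc_isolated ?R"
    using sing by (auto simp: arc_isolated_def singular_points_iff)
qed

text \<open>
  The roots of \<open>f\<close> and its logarithmic \<open>y\<close>-derivative are the vertical tangencies together with the
  singular points, and the latter stay away from any vertical tangency.
\<close>
lemma arc_isolated_vertical_tangency_points_subset:
  "arc_isolated (vertical_tangency_points f) \<subseteq>
    arc_isolated {x \<in> zero_set f. log_deriv f (axis 2 1) x = 0}" (is "_ \<subseteq> arc_isolated ?R")
proof
  fix z assume z: "z \<in> arc_isolated (vertical_tangency_points f)"
  then have vert: "z \<in> vertical_tangency_points f"
    and iso: "\<And>C. is_arc C \<Longrightarrow> C \<subseteq> vertical_tangency_points f \<Longrightarrow> z \<in> C \<Longrightarrow> C = {z}"
    by (auto simp: arc_isolated_def)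
  obtain w where w: "log_deriv f w z \<noteq> 0"
    using vert by (auto simp: vertical_tangency_points_iff singular_points_iff)
  define U where "U = positive_orthant \<inter> log_deriv f w -` (- {0})"
  have U: "open U" unfolding U_def
    by (rule continuous_open_preimage[OF continuous_on_log_deriv open_positive_orthant]) auto
  have "z \<in> U"
    unfolding U_def using vert w by (auto simp: vertical_tangency_points_iff zero_set_def)
  have "C = {z}" if C: "is_arc C" "C \<subseteq> ?R" "z \<in> C" for C
  proof (rule ccontr)
    assume "C \<noteq> {z}"
    then obtain A where A: "is_arc A" "A \<subseteq> C \<inter> U" "z \<in> A" "A \<noteq> {z}"
      using is_arc_contains_small_arc[OF C(1,3) _ U \<open>z \<in> U\<close>] by metis
    have "A \<subseteq> vertical_tangency_points f"
    proof
      fix x assume "x \<in> A"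
      then have "x \<in> ?R" "log_deriv f w x \<noteq> 0" using A(2) C(2) by (auto simp: U_def)
      then show "x \<in> vertical_tangency_points f"
        by (auto simp: vertical_tangency_points_iff singular_points_iff)
    qed
    with iso A show False by blast
  qed
  then show "z \<in> arc_isolated ?R"
    using vert by (auto simp: arc_isolated_def vertical_tangency_points_iff)
qed


section \<open>Curves invariant under a one-parameter torus\<close>

lemma arc_isolated_torus_invariant:
  fixes S :: "(real ^ 'n::finite) set"
  assumes S: "S \<subseteq> positive_orthant" and w: "w \<noteq> 0"
    and inv: "\<And>x t. x \<in> S \<Longrightarrow> torus_act (t *\<^sub>R w) x \<in> S"
  shows "arc_isolated S = {}"
proof -
  have "x \<notin> arc_isolated S" if x: "x \<in> S" for x
  proof -
    define \<gamma> where "\<gamma> t = torus_act (t *\<^sub>R w) x" for t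
    obtain i where i: "w $ i \<noteq> 0" using w by (auto simp: vec_eq_iff)
    have "x $ i \<noteq> 0" using S x positive_orthant_nonzero by blast
    then have "inj \<gamma>" using i by (auto simp: inj_on_def \<gamma>_def torus_act_def vec_eq_iff)
    then have "inj_on \<gamma> {-1..1}" by (rule inj_on_subset) simp
    moreover have "continuous_on {-1..1} \<gamma>"
      unfolding \<gamma>_def torus_act_def by (intro continuous_intros)
    ultimately have "\<gamma> 0 \<notin> arc_isolated S"
      using inv[OF x, folded \<gamma>_def] by (intro not_arc_isolated_if_curve[of 1]) auto
    then show ?thesis by (simp add: \<gamma>_def)
  qed
  then show ?thesis by (auto simp: arc_isolated_def)
qed

text \<open>
  If the exponents lie on a line with normal \<open>w\<close>, then \<open>f\<close> is multiplied by a positive factor under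
  translation along \<open>w\<close> in logarithmic coordinates, and so are the derivatives that define singular
  points and inflection points.
\<close>
lemma no_isolated_points_if_exponents_collinear:
  fixes f :: "2 fewnomial"
  assumes w: "w \<noteq> 0" and const: "\<And>a. a \<in> Poly_Mapping.keys f \<Longrightarrow> a \<bullet> w = k"
  shows "arc_isolated (singular_points f) = {}" "arc_isolated (inflection_points f) = {}"
proof -
  have mono: "monomial_val a (torus_act (t *\<^sub>R w) x) = exp (t * k) * monomial_val a x"
    if "a \<in> Poly_Mapping.keys f" "x \<in> positive_orthant" for a t x
    using monomial_val_torus_act[OF that(2)] const[OF that(1)] by simp
  have scale: "feval f (torus_act (t *\<^sub>R w) x) = exp (t * k) * feval f x"
      "log_deriv f v (torus_act (t *\<^sub>R w) x) = exp (t * k) * log_deriv f v x"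
      "line_deriv2 f v (torus_act (t *\<^sub>R w) x) = exp (t * k) * line_deriv2 f v x"
    if "x \<in> positive_orthant" for t x v
    unfolding feval_def log_deriv_def line_deriv2_def sum_distrib_left
    by (auto intro!: sum.cong simp: mono that mult_ac)
  have sub: "singular_points f \<subseteq> positive_orthant" "inflection_points f \<subseteq> positive_orthant"
    by (auto simp: singular_points_iff inflection_points_iff zero_set_def)
  have zero: "torus_act (t *\<^sub>R w) x \<in> zero_set f \<longleftrightarrow> x \<in> zero_set f" for t x
    by (auto simp: zero_set_def scale)
  have sing: "torus_act (t *\<^sub>R w) x \<in> singular_points f \<longleftrightarrow> x \<in> singular_points f" for t x
    using zero by (auto simp: singular_points_iff scale zero_set_def)
  then show "arc_isolated (singular_points f) = {}"
    by (intro arc_isolated_torus_invariant[OF sub(1) w]) simp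
  have "torus_act (t *\<^sub>R w) x \<in> inflection_points f" if "x \<in> inflection_points f" for t x
    using that sub(2) zero sing by (auto simp: inflection_points_iff subset_iff scale)
  then show "arc_isolated (inflection_points f) = {}"
    by (rule arc_isolated_torus_invariant[OF sub(2) w])
qed

lemma max_isolated_singular_le:
  "max_isolated_singular m \<le> max_isolated_roots TYPE(2) m"
  unfolding max_isolated_singular_def
proof (rule SUP_least, unfold mem_Collect_eq)
  fix f :: "2 fewnomial"
  assume f: "is_nomial m f"
  show "ecard (arc_isolated (singular_points f)) \<le> max_isolated_roots TYPE(2) m"
  proof (cases "m = 0")
    case True
    then have "Poly_Mapping.keys f = {}" using f by (simp add: is_nomial_def)
    moreover have "axis 1 1 \<noteq> (0 :: real ^ 2)" by simp
    ultimately have "arc_isolated (singular_points f) = {}"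
      by (intro no_isolated_points_if_exponents_collinear(1)) auto
    then show ?thesis by (simp add: ecard_def flip: zero_enat_def)
  next
    case False
    obtain \<theta> where "inj_on (\<lambda>a. a \<bullet> slope_dir \<theta>) (Poly_Mapping.keys f)"
      using exists_separating_direction finite_keys by blast
    from ecard_le_max_isolated_roots[OF f _ arc_isolated_singular_points_subset[OF this]] False
    show ?thesis by simp
  qed
qed

lemma max_isolated_vertical_tangency_le:
  "max_isolated_vertical_tangency m \<le> max_isolated_roots TYPE(2) m"
  unfolding max_isolated_vertical_tangency_def
proof (rule SUP_least, unfold mem_Collect_eq)
  fix f :: "2 fewnomial"
  assume f: "is_nomial m f"
  show "ecard (arc_isolated (vertical_tangency_points f)) \<le> max_isolated_roots TYPE(2) m"
  proof (cases "m = 0")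
    case True
    \<comment> \<open>The zero fewnomial is singular everywhere, so it has no tangent lines at all.\<close>
    then have "Poly_Mapping.keys f = {}" using f by (simp add: is_nomial_def)
    then have "vertical_tangency_points f = {}"
      by (auto simp: vertical_tangency_points_iff singular_points_iff log_deriv_def)
    then show ?thesis by (simp add: arc_isolated_def ecard_def flip: zero_enat_def)
  next
    case False
    with ecard_le_max_isolated_roots[OF f _ arc_isolated_vertical_tangency_points_subset]
    show ?thesis by simp
  qed
qed


section \<open>Trinomials with affinely independent exponents\<close>

lemma linear_system_2_zero:
  fixes p q :: real
  assumes "A * D - B * C \<noteq> 0" "A * p + B * q = 0" "C * p + D * q = 0"
  shows "p = 0" "q = 0"
proof -
  have "(A * D - B * C) * p = D * (A * p + B * q) - B * (C * p + D * q)"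
    "(A * D - B * C) * q = A * (C * p + D * q) - C * (A * p + B * q)"
    by algebra+
  with assms show "p = 0" "q = 0" by auto
qed

lemma cramer_rule_2:
  fixes s t :: real
  assumes "A * D - B * C \<noteq> 0"
  shows "A * ((s * D - t * B) / (A * D - B * C)) + B * ((A * t - C * s) / (A * D - B * C)) = s"
    and "C * ((s * D - t * B) / (A * D - B * C)) + D * ((A * t - C * s) / (A * D - B * C)) = t"
proof -
  have "A * (s * D - t * B) + B * (A * t - C * s) = s * (A * D - B * C)"
    "C * (s * D - t * B) + D * (A * t - C * s) = t * (A * D - B * C)"
    by algebra+
  with assms show "A * ((s * D - t * B) / (A * D - B * C)) + B * ((A * t - C * s) / (A * D - B * C)) = s"
    and "C * ((s * D - t * B) / (A * D - B * C)) + D * ((A * t - C * s) / (A * D - B * C)) = t"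
    by (simp_all add: add_divide_distrib[symmetric])
qed

locale noncollinear_trinomial =
  fixes f :: "2 fewnomial" and a b c :: "real ^ 2"
  assumes keys: "Poly_Mapping.keys f = {a, b, c}"
    and noncollinear: "(a $ 1 - c $ 1) * (b $ 2 - c $ 2) - (b $ 1 - c $ 1) * (a $ 2 - c $ 2) \<noteq> 0"
begin

lemma distinct_exponents: "a \<noteq> b" "a \<noteq> c" "b \<noteq> c"
  using noncollinear by auto

definition term_val :: "real ^ 2 \<Rightarrow> real ^ 2 \<Rightarrow> real" where
  "term_val e x = Poly_Mapping.lookup f e * monomial_val e x"

definition ratio :: "real ^ 2 \<Rightarrow> real" where
  "ratio x = term_val a x / term_val b x"

lemma term_val_nonzero:
  "e \<in> {a, b, c} \<Longrightarrow> x \<in> positive_orthant \<Longrightarrow> term_val e x \<noteq> 0"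
  using monomial_val_pos[of x e] by (auto simp: term_val_def in_keys_iff simp flip: keys)

lemma term_val_torus_act:
  "x \<in> positive_orthant \<Longrightarrow> term_val e (torus_act d x) = exp (e \<bullet> d) * term_val e x"
  by (simp add: term_val_def monomial_val_torus_act)

lemma feval_terms: "feval f x = term_val a x + term_val b x + term_val c x"
  unfolding feval_def keys using distinct_exponents by (simp add: term_val_def)

lemma log_deriv_terms:
  "log_deriv f w x = (a \<bullet> w) * term_val a x + (b \<bullet> w) * term_val b x + (c \<bullet> w) * term_val c x"
  unfolding log_deriv_def keys using distinct_exponents by (simp add: term_val_def)

text \<open>
  The equation \<open>f = 0\<close> leaves one degree of freedom for the three terms up to a common factor, and
  the ratio captures it.
\<close>
lemma terms_on_zero_set:
  assumes "x \<in> zero_set f"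
  shows "term_val a x = ratio x * term_val b x" "term_val c x = - (1 + ratio x) * term_val b x"
    and "ratio x \<noteq> 0" "1 + ratio x \<noteq> 0"
proof -
  have x: "x \<in> positive_orthant" and sum: "term_val a x + term_val b x + term_val c x = 0"
    using assms by (auto simp: zero_set_def feval_terms)
  note nz = term_val_nonzero[OF _ x]
  show *: "term_val a x = ratio x * term_val b x" using nz by (simp add: ratio_def)
  with sum show **: "term_val c x = - (1 + ratio x) * term_val b x" by (simp add: algebra_simps)
  show "ratio x \<noteq> 0" "1 + ratio x \<noteq> 0" using * ** nz[of a] nz[of c] by auto
qed

text \<open>
  At a singular point the three nonzero terms would give an affine dependence of the exponents.
\<close>
lemma singular_points_empty: "singular_points f = {}"
proof (rule ccontr)
  assume "singular_points f \<noteq> {}"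
  then obtain x where x: "x \<in> zero_set f" and sing: "\<And>w. log_deriv f w x = 0"
    unfolding singular_points_iff ex_in_conv[symmetric] by blast
  have "x \<in> positive_orthant" and sum: "term_val c x = - term_val a x - term_val b x"
    using x by (auto simp: zero_set_def feval_terms)
  have "(a $ i - c $ i) * term_val a x + (b $ i - c $ i) * term_val b x = 0" for i
    using sing[of "axis i 1"] by (simp add: log_deriv_terms inner_axis sum algebra_simps)
  from linear_system_2_zero(1)[OF noncollinear this this] term_val_nonzero[OF _ \<open>x \<in> positive_orthant\<close>]
  show False by simp
qed

text \<open>
  Two points with the same ratio have proportional terms, so in logarithmic coordinates they
  differ by a vector orthogonal to all differences of exponents.
\<close>
lemma ratio_inj: "inj_on ratio (zero_set f)"
proof (rule inj_onI)
  fix x y assume x: "x \<in> zero_set f" and y: "y \<in> zero_set f" and eq: "ratio x = ratio y"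
  have pos: "x \<in> positive_orthant" "y \<in> positive_orthant" using x y by (auto simp: zero_set_def)
  define d where "d = (\<chi> i. ln (y $ i / x $ i))"
  have y_eq: "torus_act d x = y" unfolding d_def by (rule torus_act_ln_quotient[OF pos])
  have scale: "term_val e y = exp (e \<bullet> d) * term_val e x" for e
    using term_val_torus_act[OF pos(1), of e d] y_eq by simp
  have nz: "term_val b x \<noteq> 0" "ratio y \<noteq> 0" "1 + ratio y \<noteq> 0"
    using term_val_nonzero[OF _ pos(1)] terms_on_zero_set[OF y] by auto
  have "exp (a \<bullet> d) * (ratio y * term_val b x) = ratio y * (exp (b \<bullet> d) * term_val b x)"
    using terms_on_zero_set(1)[OF x] terms_on_zero_set(1)[OF y] scale[of a] scale[of b] eq by simp
  then have ab: "a \<bullet> d = b \<bullet> d" using nz by simp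
  have "exp (c \<bullet> d) * (- (1 + ratio y) * term_val b x) = - (1 + ratio y) * (exp (b \<bullet> d) * term_val b x)"
    using terms_on_zero_set(2)[OF x] terms_on_zero_set(2)[OF y] scale[of c] scale[of b] eq by simp
  then have "(1 + ratio y) * term_val b x * (exp (c \<bullet> d) - exp (b \<bullet> d)) = 0" by (simp add: algebra_simps)
  then have cb: "c \<bullet> d = b \<bullet> d" using nz by simp
  have "(a $ 1 - c $ 1) * d $ 1 + (a $ 2 - c $ 2) * d $ 2 = 0"
    "(b $ 1 - c $ 1) * d $ 1 + (b $ 2 - c $ 2) * d $ 2 = 0"
    using ab cb by (simp_all add: inner_vec_def sum_2 algebra_simps)
  moreover have "(a $ 1 - c $ 1) * (b $ 2 - c $ 2) - (a $ 2 - c $ 2) * (b $ 1 - c $ 1) \<noteq> 0"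
    using noncollinear by (metis mult.commute)
  ultimately have "d $ 1 = 0" "d $ 2 = 0" using linear_system_2_zero by blast+
  then have "d = 0" by (simp add: vec_eq_iff forall_2)
  with y_eq show "x = y" by simp
qed

text \<open>
  Up to a factor, the logarithmic gradient at a point of the curve is \<open>(normal 1, normal 2)\<close>
  evaluated at the ratio; \<open>bending e\<close> is the coefficient of the term with exponent \<open>e\<close> in
  \<open>line_deriv2\<close> along the corresponding tangent vector.
\<close>
definition normal :: "2 \<Rightarrow> real poly" where
  "normal i = [:b $ i - c $ i, a $ i - c $ i:]"

definition bending :: "real ^ 2 \<Rightarrow> real poly" where
  "bending e = (smult (e $ 2) (normal 1) - smult (e $ 1) (normal 2)) ^ 2
     - smult (e $ 1) (normal 2 ^ 2) - smult (e $ 2) (normal 1 ^ 2)"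

definition inflection_poly :: "real poly" where
  "inflection_poly = [:0, 1:] * bending a + bending b - [:1, 1:] * bending c"

lemma degree_inflection_poly: "degree inflection_poly \<le> 3"
proof -
  have pow: "degree (p ^ 2) \<le> 2" if "degree p \<le> 1" for p :: "real poly"
    using degree_power_le[of p 2] that by simp
  have "degree (normal i) \<le> 1" for i by (simp add: normal_def)
  then have bending: "degree (bending e) \<le> 2" for e
    unfolding bending_def
    by (intro degree_diff_le pow order.trans[OF degree_smult_le])
  have prod: "degree ([:s, 1:] * bending e) \<le> 3" for s e
    using degree_mult_le[of "[:s, 1:]" "bending e"] bending[of e] by simp
  then show ?thesis
    unfolding inflection_poly_def
    by (intro degree_diff_le degree_add_le prod order.trans[OF bending[of b]]) simp
qed

text \<open>
  The inflection condition is a cubic form in the three terms, and these are proportional to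
  \<open>ratio x\<close>, \<open>1\<close> and \<open>-1 - ratio x\<close>.
\<close>
lemma inflection_points_eq: "inflection_points f = {x \<in> zero_set f. poly inflection_poly (ratio x) = 0}"
proof -
  have "x \<in> inflection_points f \<longleftrightarrow> poly inflection_poly (ratio x) = 0" if x: "x \<in> zero_set f" for x
  proof -
    define n where "n i = log_deriv f (axis i 1) x" for i
    define w0 :: "real ^ 2" where "w0 = (\<chi> i. if i = 1 then - n 2 else n 1)"
    define \<rho> E where "\<rho> = ratio x" and "E = term_val b x"
    have E: "E \<noteq> 0" using x term_val_nonzero[of b x] by (simp add: E_def zero_set_def)
    note T = terms_on_zero_set(1,2)[OF x, folded \<rho>_def E_def]
    have n: "n i = E * poly (normal i) \<rho>" for i
      by (simp add: n_def log_deriv_terms inner_axis T normal_def algebra_simps flip: E_def)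
    have ld: "log_deriv f w x = w $ 1 * n 1 + w $ 2 * n 2" for w
      by (simp add: n_def log_deriv_terms inner_vec_def sum_2 axis_def algebra_simps)
    have bend: "(e \<bullet> w0)\<^sup>2 - e \<bullet> (\<chi> i. (w0 $ i)\<^sup>2) = E\<^sup>2 * poly (bending e) \<rho>" for e
      by (simp add: w0_def inner_vec_def sum_2 n bending_def power2_eq_square algebra_simps)
    have "line_deriv2 f w0 x = (\<Sum>e\<in>{a, b, c}. term_val e x * ((e \<bullet> w0)\<^sup>2 - e \<bullet> (\<chi> i. (w0 $ i)\<^sup>2)))"
      unfolding line_deriv2_def keys by (simp add: term_val_def mult_ac)
    also have "\<dots> = E ^ 3 * poly inflection_poly \<rho>"
      unfolding bend using distinct_exponents
      by (simp add: T inflection_poly_def power2_eq_square power3_eq_cube algebra_simps flip: E_def)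
    finally have l2: "line_deriv2 f w0 x = E ^ 3 * poly inflection_poly \<rho>" .
    have nonsing: "x \<in> zero_set f - singular_points f" using x singular_points_empty by simp
    have n_nz: "n 1 \<noteq> 0 \<or> n 2 \<noteq> 0"
    proof (rule ccontr)
      assume "\<not> (n 1 \<noteq> 0 \<or> n 2 \<noteq> 0)"
      then have "x \<in> singular_points f" using x by (simp add: singular_points_iff ld)
      with nonsing show False by simp
    qed
    then have N: "(n 1)\<^sup>2 + (n 2)\<^sup>2 \<noteq> 0" by (simp add: sum_power2_eq_zero_iff)
    have w0: "w0 \<noteq> 0" "log_deriv f w0 x = 0"
      using n_nz by (auto simp: w0_def vec_eq_iff forall_2 ld)
    show ?thesis
    proof
      assume "x \<in> inflection_points f"
      then obtain w where w: "w \<noteq> 0" "log_deriv f w x = 0" "line_deriv2 f w x = 0"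
        by (auto simp: inflection_points_iff)
      \<comment> \<open>The tangent direction is unique up to scaling.\<close>
      define k where "k = (n 1 * w $ 2 - n 2 * w $ 1) / ((n 1)\<^sup>2 + (n 2)\<^sup>2)"
      have "w $ 1 * ((n 1)\<^sup>2 + (n 2)\<^sup>2) = (n 1 * w $ 2 - n 2 * w $ 1) * - n 2 + n 1 * (w $ 1 * n 1 + w $ 2 * n 2)"
        "w $ 2 * ((n 1)\<^sup>2 + (n 2)\<^sup>2) = (n 1 * w $ 2 - n 2 * w $ 1) * n 1 + n 2 * (w $ 1 * n 1 + w $ 2 * n 2)"
        by algebra+
      moreover have "w $ 1 * n 1 + w $ 2 * n 2 = 0" using w(2) by (simp add: ld)
      ultimately have "w $ 1 = (n 1 * w $ 2 - n 2 * w $ 1) * - n 2 / ((n 1)\<^sup>2 + (n 2)\<^sup>2)"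
        "w $ 2 = (n 1 * w $ 2 - n 2 * w $ 1) * n 1 / ((n 1)\<^sup>2 + (n 2)\<^sup>2)"
        using N by (simp_all only: eq_divide_eq not_False_eq_True if_True mult_zero_right add_0_right)
      then have "w = k *\<^sub>R w0"
        unfolding k_def by (simp add: vec_eq_iff forall_2 w0_def)
      with w(1,3) have "line_deriv2 f w0 x = 0"
        by (auto simp: line_deriv2_scaleR)
      then show "poly inflection_poly (ratio x) = 0" using l2 E by (simp add: \<rho>_def)
    next
      assume "poly inflection_poly (ratio x) = 0"
      then have "line_deriv2 f w0 x = 0" using l2 by (simp add: \<rho>_def)
      with w0 nonsing show "x \<in> inflection_points f" by (auto simp: inflection_points_iff)
    qed
  qed
  moreover have "inflection_points f \<subseteq> zero_set f"
    unfolding inflection_points_iff subset_iff by blast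
  ultimately show ?thesis by blast
qed

text \<open>
  The curve is parametrised by the logarithm of the ratio: the two quotients of terms determine
  the point, because the exponents are affinely independent.
\<close>
lemma arc_isolated_zero_set: "arc_isolated (zero_set f) = {}"
proof -
  have "x \<notin> arc_isolated (zero_set f)" if x: "x \<in> zero_set f" for x
  proof -
    have pos: "x \<in> positive_orthant" using x by (simp add: zero_set_def)
    define \<rho> where "\<rho> = ratio x"
    note T = terms_on_zero_set[OF x, folded \<rho>_def]
    define h where "h t = (1 + \<rho> * exp t) / (1 + \<rho>)" for t
    define D where "D = (a $ 1 - b $ 1) * (c $ 2 - b $ 2) - (a $ 2 - b $ 2) * (c $ 1 - b $ 1)"
    have "D = - ((a $ 1 - c $ 1) * (b $ 2 - c $ 2) - (b $ 1 - c $ 1) * (a $ 2 - c $ 2))"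
      unfolding D_def by (simp add: algebra_simps)
    with noncollinear have D: "D \<noteq> 0" by simp
    \<comment> \<open>Cramer's rule for \<open>(a - b) \<bullet> d t = t\<close> and \<open>(c - b) \<bullet> d t = ln (h t)\<close>.\<close>
    define d :: "real \<Rightarrow> real ^ 2" where "d t = (\<chi> i. if i = 1
        then (t * (c $ 2 - b $ 2) - ln (h t) * (a $ 2 - b $ 2)) / D
        else ((a $ 1 - b $ 1) * ln (h t) - (c $ 1 - b $ 1) * t) / D)" for t
    have dots: "a \<bullet> d t = b \<bullet> d t + t" "c \<bullet> d t = b \<bullet> d t + ln (h t)" for t
    proof -
      have "(a $ 1 - b $ 1) * d t $ 1 + (a $ 2 - b $ 2) * d t $ 2 = t"
        "(c $ 1 - b $ 1) * d t $ 1 + (c $ 2 - b $ 2) * d t $ 2 = ln (h t)"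
        using cramer_rule_2[OF D[unfolded D_def]] by (simp_all add: d_def D_def)
      then show "a \<bullet> d t = b \<bullet> d t + t" "c \<bullet> d t = b \<bullet> d t + ln (h t)"
        by (simp_all add: inner_vec_def sum_2 algebra_simps)
    qed
    have h_cont: "continuous_on S h" for S unfolding h_def using T(4) by (intro continuous_intros) auto
    have "open (h -` {0<..})" by (intro open_vimage h_cont) auto
    moreover have "0 \<in> h -` {0<..}" using T(4) by (simp add: h_def)
    ultimately obtain e where e: "e > 0" "cball 0 e \<subseteq> h -` {0<..}"
      using open_contains_cball by blast
    have h: "h t > 0" if "t \<in> {-e..e}" for t
      using that e(2) by (auto simp: subset_iff abs_le_iff)
    define \<gamma> where "\<gamma> t = torus_act (d t) x" for t
    have "inj \<gamma>"
    proof (rule injI)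
      fix s t assume "\<gamma> s = \<gamma> t"
      then have "d s = d t"
        by (simp add: \<gamma>_def torus_act_def vec_eq_iff positive_orthant_nonzero[OF pos])
      then show "s = t" using dots(1) by (metis add_left_cancel)
    qed
    moreover have "continuous_on {-e..e} \<gamma>"
    proof -
      have "continuous_on {-e..e} (\<lambda>t. d t $ i)" for i
        using h D by (cases "i = 1") (auto simp: d_def intro!: continuous_intros h_cont dest!: h)
      then show ?thesis unfolding \<gamma>_def torus_act_def
        by (intro continuous_on_vec_lambda continuous_on_mult continuous_on_const continuous_on_exp)
    qed
    moreover have "\<gamma> t \<in> zero_set f" if "t \<in> {-e..e}" for t
    proof -
      have "feval f (\<gamma> t) = exp (b \<bullet> d t) *
          (exp t * term_val a x + term_val b x + h t * term_val c x)"
        unfolding feval_terms \<gamma>_def term_val_torus_act[OF pos] dots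
        using h[OF that] by (simp add: exp_add algebra_simps)
      also have "exp t * term_val a x + term_val b x + h t * term_val c x = 0"
        using T(4) by (simp add: T(1,2) h_def field_simps)
      finally show ?thesis using pos by (simp add: zero_set_def \<gamma>_def)
    qed
    ultimately have "\<gamma> 0 \<notin> arc_isolated (zero_set f)"
      using e(1) inj_on_subset[of \<gamma> UNIV] by (intro not_arc_isolated_if_curve[of e]) auto
    moreover have "\<gamma> 0 = x"
    proof -
      have "d 0 = 0" using T(4) by (simp add: d_def vec_eq_iff h_def)
      then show ?thesis by (simp add: \<gamma>_def)
    qed
    ultimately show ?thesis by simp
  qed
  then show ?thesis by (auto simp: arc_isolated_def)
qed

lemma ecard_arc_isolated_inflection_points: "ecard (arc_isolated (inflection_points f)) \<le> 3"
proof (cases "inflection_poly = 0")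
  case True
  then have "arc_isolated (inflection_points f) = {}"
    using arc_isolated_zero_set by (simp add: inflection_points_eq)
  then show ?thesis by (simp add: ecard_def flip: zero_enat_def)
next
  case False
  define R where "R = {r. poly inflection_poly r = 0}"
  have R: "finite R" "card R \<le> 3"
    using poly_roots_finite[OF False] card_poly_roots_bound[OF False] degree_inflection_poly
    by (auto simp: R_def)
  have sub: "ratio ` inflection_points f \<subseteq> R" and inj: "inj_on ratio (inflection_points f)"
    using inj_on_subset[OF ratio_inj] by (auto simp: inflection_points_eq R_def)
  then have fin: "finite (inflection_points f)" using R(1) finite_subset inj_on_finite by metis
  have "card (inflection_points f) \<le> 3"
    using card_inj_on_le[OF inj sub R(1)] R(2) by simp
  then have "ecard (inflection_points f) \<le> 3"
    using fin by (simp add: ecard_def numeral_eq_enat)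
  moreover have "arc_isolated (inflection_points f) \<subseteq> inflection_points f"
    by (auto simp: arc_isolated_def)
  ultimately show ?thesis using ecard_mono order_trans by blast
qed

end


section \<open>Counting for at most three terms\<close>

lemma few_exponents_cases:
  fixes f :: "2 fewnomial"
  assumes "is_nomial m f" "m \<le> 3"
  obtains w k where "w \<noteq> 0" "\<And>e. e \<in> Poly_Mapping.keys f \<Longrightarrow> e \<bullet> w = k"
  | a b c where "m = 3" "noncollinear_trinomial f a b c"
proof -
  note on_line = that(1) and spread = that(2)
  have collinear: thesis
    if sub: "Poly_Mapping.keys f \<subseteq> {a, b, c}"
      and det: "(a $ 1 - c $ 1) * (b $ 2 - c $ 2) - (b $ 1 - c $ 1) * (a $ 2 - c $ 2) = 0" for a b c
  proof -
    define n :: "real ^ 2 \<Rightarrow> real ^ 2" where "n v = (\<chi> i. if i = 1 then - v $ 2 else v $ 1)" for v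
    have n: "v \<bullet> n u = u $ 1 * v $ 2 - u $ 2 * v $ 1" "n u = 0 \<longleftrightarrow> u = 0" for u v
      by (auto simp: n_def inner_vec_def sum_2 vec_eq_iff forall_2)
    \<comment> \<open>A normal to the line: from a nonzero difference of exponents if there is one.\<close>
    define w where "w = (if a \<noteq> c then n (a - c) else if b \<noteq> c then n (b - c) else axis 1 1)"
    have "w \<noteq> 0" by (simp add: w_def n)
    moreover have "(a - c) \<bullet> w = 0" "(b - c) \<bullet> w = 0"
      using det by (auto simp: w_def n algebra_simps)
    then have "e \<bullet> w = c \<bullet> w" if "e \<in> Poly_Mapping.keys f" for e
      using that sub by (auto simp: inner_diff_left)
    ultimately show thesis by (rule on_line)
  qed
  have card: "card (Poly_Mapping.keys f) = m" using assms(1) by (simp add: is_nomial_def)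
  consider "m = 0" | "m = 1" | "m = 2" | "m = 3" using assms(2) by linarith
  then show thesis
  proof cases
    case 1
    with card show thesis using collinear[of 0 0 0] by simp
  next
    case 2
    with card obtain a where "Poly_Mapping.keys f = {a}" by (auto simp: card_1_singleton_iff)
    then show thesis using collinear[of a a a] by simp
  next
    case 3
    with card obtain a b where "Poly_Mapping.keys f = {a, b}" by (auto simp: card_2_iff)
    then show thesis using collinear[of a b b] by simp
  next
    case 4
    with card obtain a b c where "Poly_Mapping.keys f = {a, b, c}" by (auto simp: card_3_iff)
    then show thesis
      using collinear[of a b c] spread[OF 4, of a b c] by (auto simp: noncollinear_trinomial_def)
  qed
qed

lemma max_isolated_singular_eq_0:
  assumes "m \<le> 3"
  shows "max_isolated_singular m = 0"
proof -
  have "arc_isolated (singular_points f) = {}" if "is_nomial m f" for f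
    using few_exponents_cases[OF that assms]
  proof cases
    case 1
    then show ?thesis by (rule no_isolated_points_if_exponents_collinear(1))
  next
    case 2
    then show ?thesis by (simp add: noncollinear_trinomial.singular_points_empty arc_isolated_def)
  qed
  then have "max_isolated_singular m \<le> 0"
    unfolding max_isolated_singular_def by (intro SUP_least) (simp add: ecard_def flip: zero_enat_def)
  then show ?thesis by simp
qed

lemma max_isolated_inflection_le:
  assumes "m \<le> 3"
  shows "max_isolated_inflection m \<le> (if m = 3 then 3 else 0)"
  unfolding max_isolated_inflection_def
proof (rule SUP_least, unfold mem_Collect_eq)
  fix f :: "2 fewnomial"
  assume "is_nomial m f"
  from few_exponents_cases[OF this assms]
  show "ecard (arc_isolated (inflection_points f)) \<le> (if m = 3 then 3 else 0)"
  proof cases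
    case 1
    then have "arc_isolated (inflection_points f) = {}"
      by (rule no_isolated_points_if_exponents_collinear(2))
    then show ?thesis by (simp add: ecard_def flip: zero_enat_def)
  next
    case 2
    then show ?thesis using noncollinear_trinomial.ecard_arc_isolated_inflection_points by auto
  qed
qed

text \<open>
  The witness is the linear system \<open>x\<^sub>i - 1 = 0\<close> with the root \<open>(1, \<dots>, 1)\<close>; its exponents are the
  origin and the unit vectors.
\<close>
lemma max_nondegenerate_roots_simplex:
  "1 \<le> max_nondegenerate_roots TYPE('n::finite) (CARD('n) + 1)"
proof -
  define F :: "'n \<Rightarrow> 'n fewnomial" where
    "F i = Poly_Mapping.single (axis i 1) 1 + Poly_Mapping.single 0 (-1)" for i
  have ax: "axis i (1 :: real) \<noteq> 0" for i :: 'n by simp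
  have look: "Poly_Mapping.lookup (F i) e = (if e = axis i 1 then 1 else if e = 0 then -1 else 0)" for i e
    using ax[of i] by (auto simp: F_def lookup_add lookup_single when_def)
  have keys: "Poly_Mapping.keys (F i) = {axis i 1, 0}" for i
    by (auto simp: in_keys_iff look split: if_splits)
  have mono: "monomial_val (axis i 1) x = x $ i" "monomial_val 0 x = 1"
    if x: "x \<in> positive_orthant" for x :: "real ^ 'n" and i
  proof -
    have "monomial_val (axis i 1) x = (\<Prod>j\<in>UNIV. if j = i then x $ i else 1)"
      unfolding monomial_val_def
      by (intro prod.cong refl) (auto simp: axis_def positive_orthant_nonzero[OF x] less_imp_le[OF positive_orthantD[OF x]])
    then show "monomial_val (axis i 1) x = x $ i" by simp
    show "monomial_val 0 x = 1"
      unfolding monomial_val_def using positive_orthant_nonzero[OF x] by simp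
  qed
  have eval: "system_eval F x = x - 1" if "x \<in> positive_orthant" for x
    using ax that by (simp add: system_eval_def feval_def keys look mono vec_eq_iff)
  have pos: "(1 :: real ^ 'n) \<in> positive_orthant" by (simp add: positive_orthant_def)
  have "((\<lambda>x :: real ^ 'n. x - 1) has_derivative id) (at 1)"
    by (auto intro!: derivative_eq_intros simp: id_def)
  then have "(system_eval F has_derivative id) (at 1)"
    by (rule has_derivative_transform_within_open[OF _ open_positive_orthant pos]) (simp add: eval)
  then have "jacobian (system_eval F) (at 1) = mat 1"
    by (simp add: jacobian_def frechet_derivative_at[symmetric] matrix_id_mat_1)
  then have root: "1 \<in> nondegenerate_roots F"
    using pos by (simp add: nondegenerate_roots_def system_roots_def eval rank_I)
  have "system_exponents F = insert 0 (range (\<lambda>i. axis i 1))"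
    by (auto simp: system_exponents_def keys)
  moreover have "inj (\<lambda>i. axis i (1::real) :: real ^ 'n)" by (auto simp: inj_on_def axis_eq_axis)
  then have "card (range (\<lambda>i. axis i 1 :: real ^ 'n)) = CARD('n)" by (simp add: card_image)
  moreover have "0 \<notin> range (\<lambda>i. axis i 1 :: real ^ 'n)" using ax by (metis imageE)
  ultimately have "card (system_exponents F) = CARD('n) + 1" by simp
  moreover have "fewnomial_system F"
    using ax by (auto simp: fewnomial_system_def is_nomial_def keys)
  ultimately have "ecard (nondegenerate_roots F) \<le> max_nondegenerate_roots TYPE('n) (CARD('n) + 1)"
    unfolding max_nondegenerate_roots_def by (intro SUP_upper) simp
  moreover have "1 \<le> ecard (nondegenerate_roots F)"
    using ecard_mono[of "{1}" "nondegenerate_roots F"] root by (simp add: ecard_def one_enat_def)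
  ultimately show ?thesis by (rule order_trans[rotated])
qed

theorem theorem4:
  fixes m :: nat
  shows "max_isolated_singular m \<le> max_isolated_roots TYPE(2) m
       \<and> max_isolated_vertical_tangency m \<le> max_isolated_roots TYPE(2) m
       \<and> (m \<le> 3 \<longrightarrow> max_isolated_singular m + max_isolated_inflection m
                      \<le> 3 * max_nondegenerate_roots TYPE(2) m)"
proof (intro conjI impI)
  show "max_isolated_singular m \<le> max_isolated_roots TYPE(2) m"
    by (rule max_isolated_singular_le)
  show "max_isolated_vertical_tangency m \<le> max_isolated_roots TYPE(2) m"
    by (rule max_isolated_vertical_tangency_le)
  assume m: "m \<le> 3"
  have "max_isolated_inflection m \<le> 3 * max_nondegenerate_roots TYPE(2) m"
  proof (cases "m = 3")
    case True
    have "1 \<le> max_nondegenerate_roots TYPE(2) 3"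
      using max_nondegenerate_roots_simplex[where 'n = 2] by simp
    then have "3 * 1 \<le> 3 * max_nondegenerate_roots TYPE(2) 3" by (rule mult_left_mono) simp
    with max_isolated_inflection_le[OF m] True show ?thesis by (simp add: order_trans)
  next
    case False
    with max_isolated_inflection_le[OF m] show ?thesis by simp
  qed
  then show "max_isolated_singular m + max_isolated_inflection m \<le> 3 * max_nondegenerate_roots TYPE(2) m"
    by (simp add: max_isolated_singular_eq_0[OF m])
qed

end
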